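(* For all positive integers $j$ and $k$, $\{ n-(j+1) : n \in \mathbf{B}_{j+1}^k,\ n > j+1\} \subseteq \{ n-j : n \in \mathbf{B}_j^k,\ n > j\}.$
   Context: For positive integers $j,k$, a positive integer $n$ is called $(j,k)$-representable if $n = x_1^k + \cdots + x_j^k$ with all $x_i$ positive integers. $\mathbf{B}_j^k$ denotes the set of positive integers that are not $(j,k)$-representable. *)

theory Defs
  imports Main
begin

definition representable :: "nat \<Rightarrow> nat \<Rightarrow> nat \<Rightarrow> bool" where
  "representable j k n \<longleftrightarrow>
     (\<exists>x :: nat \<Rightarrow> nat. (\<forall>i\<in>{1..j}. x i > 0) \<and> n = (\<Sum>i=1..j. x i ^ k))"

definition nonrepresentable :: "nat \<Rightarrow> nat \<Rightarrow> nat set" where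
  "nonrepresentable j k = {n. n > 0 \<and> \<not> representable j k n}"

end

theory Submission
  imports Defs
begin

text \<open>Since \<open>1 ^ k = 1\<close>, appending the base 1 turns a sum of \<open>j\<close>
  positive \<open>k\<close>-th powers equal to \<open>n\<close> into a sum of \<open>j + 1\<close>
  of them equal to \<open>n + 1\<close>. Contrapositively, non-representability of \<open>n\<close>
  by \<open>j + 1\<close> powers passes to \<open>n - 1\<close> with \<open>j\<close> powers, and
  the shifted value \<open>n - (j + 1) = (n - 1) - j\<close> is unchanged.\<close>

lemma representable_Suc:
  assumes "representable j k n"
  shows "representable (Suc j) k (Suc n)"
proof -
  obtain x :: "nat \<Rightarrow> nat" where pos: "\<forall>i\<in>{1..j}. x i > 0" and n: "n = (\<Sum>i=1..j. x i ^ k)"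
    using assms unfolding representable_def by blast
  \<comment> \<open>The updated index \<open>Suc j\<close> lies outside \<open>{1..j}\<close>, so
    the old sum is untouched.\<close>
  have "(\<Sum>i=1..j. (x(Suc j := 1)) i ^ k) = (\<Sum>i=1..j. x i ^ k)"
    by (rule sum.cong) auto
  then have "Suc n = (\<Sum>i=1..Suc j. (x(Suc j := 1)) i ^ k)"
    by (simp add: n)
  moreover have "\<forall>i\<in>{1..Suc j}. (x(Suc j := 1)) i > 0"
    using pos by auto
  ultimately show ?thesis
    unfolding representable_def by blast
qed

theorem theorem10p9:
  fixes j k :: nat
  assumes "j > 0" and "k > 0"
  shows "{n - (j + 1) | n. n \<in> nonrepresentable (j + 1) k \<and> n > j + 1}
    \<subseteq> {n - j | n. n \<in> nonrepresentable j k \<and> n > j}"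
proof
  fix m
  assume "m \<in> {n - (j + 1) | n. n \<in> nonrepresentable (j + 1) k \<and> n > j + 1}"
  then obtain n where m: "m = n - (j + 1)" and n: "n > j + 1" "\<not> representable (Suc j) k n"
    by (auto simp: nonrepresentable_def)
  \<comment> \<open>As \<open>n > j + 1\<close>, the subtraction is not truncated and
    \<open>Suc (n - 1) = n\<close>.\<close>
  have "\<not> representable j k (n - 1)"
    using representable_Suc[of j k "n - 1"] n by auto
  then have "n - 1 \<in> nonrepresentable j k"
    using n by (simp add: nonrepresentable_def)
  moreover have "m = (n - 1) - j" "n - 1 > j"
    using m n by auto
  ultimately show "m \<in> {n - j | n. n \<in> nonrepresentable j k \<and> n > j}"
    by blast
qed

end
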